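(* Fix $m,p\in\mathbb N$. Let $X,Y$ be separable Hilbert spaces, $D_G\subset X$ closed, and $G:D_G\to Y$ continuous. Assume logarithmic stability: there are constants $C_{\mathrm{stab}}>0$, $\beta\in(0,1)$, $\tau\in(0,1)$ such that $$\|G(x_1)-G(x_2)\|_Y\le C_{\mathrm{stab}}\,|\log\|x_1-x_2\|_X|^{-\beta}$$ for all $x_1,x_2\in D_G$ with $\|x_1-x_2\|_X\le\tau$ (with the convention $|\log 0|^{-\beta}:=0$). Let $\mu$ be a Borel probability measure on $X$ with $\mu(D_G)=1$ and finite second moment, and let $\mathcal E:X\to\mathbb R^m$ be Borel measurable. Let $\mathcal D:\mathbb R^m\to X$ and $\mathcal P:Y\to\mathbb R^p$ be Lipschitz continuous, and suppose that $K:=\operatorname{supp}(\mathcal E_\#\mu)\subset\mathbb R^m$ is compact and $\mathcal D(K)\subset D_G$. Define $H:=\mathcal P\circ G\circ\mathcal D:K\to\mathbb R^p$. Then there exist constants $c_0,c_1,c_2,c_3>0$, which may depend on $m,p$ and on the fixed data above but not on $\eta$ or $N$ below, such that the following hold. (i) For every $\eta\in(0,1)$ there is a ReLU neural network $\mathcal A_\eta:\mathbb R^m\to\mathbb R^p$ with $$\|\mathcal A_\eta-H\|_{L^2(K,\mathcal E_\#\mu)}\le\eta,$$ $$\mathrm{size}(\mathcal A_\eta)\le c_0(p+1)\exp\bigl(c_1m\eta^{-1/\beta}\bigr),\qquad \mathrm{depth}(\mathcal A_\eta)\le c_2+c_3m\eta^{-1/\beta}.$$ (ii) For $N\in\mathbb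 N$ let $$\mathscr E_{\mathcal A}(N):=\inf\bigl\{\|\mathcal A-H\|_{L^2(K,\mathcal E_\#\mu)}:\ \mathcal A:\mathbb R^m\to\mathbb R^p\text{ a ReLU network with }\mathrm{size}(\mathcal A)\le N\bigr\},$$ and set $N_0:=c_0(p+1)\exp(c_1m)$. Then for every $N>N_0$, $$\mathscr E_{\mathcal A}(N)\le\left[\frac1{c_1m}\log\left(\frac N{c_0(p+1)}\right)\right]^{-\beta}.$$
   Context: ReLU network: a map $\Phi=C_\Lambda\circ\sigma\circ C_{\Lambda-1}\circ\cdots\circ\sigma\circ C_1$ where $\Lambda\ge1$, $\sigma(x)=\max\{x,0\}$ acts componentwise, and $C_\ell(z)=W_\ell z+b_\ell$ are affine maps with $W_\ell\in\mathbb R^{d_{\ell+1}\times d_\ell}$, $b_\ell\in\mathbb R^{d_{\ell+1}}$. With $\|A\|_0$ the number of nonzero entries of a matrix or vector $A$, $\mathrm{size}(\Phi):=\sum_{\ell=1}^{\Lambda}(\|W_\ell\|_0+\|b_\ell\|_0)$ and $\mathrm{depth}(\Phi):=\Lambda-1$ (these refer to a chosen representation of the network). $\mathcal E_\#\mu$ is the pushforward measure; $\mathbb R^p$, $\mathbb R^m$ carry Euclidean norms. *)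

theory Defs
  imports "HOL-Probability.Probability" "Jordan_Normal_Form.Matrix"
begin

text \<open>
  A representation of a ReLU network is the list of its affine layers (weight matrix, bias), in
  the order of application. The widths of the layers vary along the list, so the layers use the
  matrices and vectors of \<^theory>\<open>Jordan_Normal_Form.Matrix\<close>, whose dimensions are values.
\<close>

type_synonym relu_net = "(real mat \<times> real vec) list"

definition relu :: "real \<Rightarrow> real" where
  "relu x = max x 0"

text \<open>
  The network is nonempty, and consecutive layers fit; the first argument is the input dimension,
  the second one the output dimension.
\<close>

fun is_relu_net :: "nat \<Rightarrow> nat \<Rightarrow> relu_net \<Rightarrow> bool" where
  "is_relu_net d d' [] \<longleftrightarrow> False"
| "is_relu_net d d' [(W, b)] \<longleftrightarrow>
     0 < d \<and> 0 < d' \<and> W \<in> carrier_mat d' d \<and> b \<in> carrier_vec d'"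
| "is_relu_net d d' ((W, b) # L # Ls) \<longleftrightarrow>
     0 < d \<and> W \<in> carrier_mat (dim_vec b) d \<and> is_relu_net (dim_vec b) d' (L # Ls)"

text \<open>The activation is applied between the layers, but not after the last one.\<close>

fun realize_vec :: "relu_net \<Rightarrow> real vec \<Rightarrow> real vec" where
  "realize_vec [] x = x"
| "realize_vec [(W, b)] x = W *\<^sub>v x + b"
| "realize_vec ((W, b) # L # Ls) x = realize_vec (L # Ls) (map_vec relu (W *\<^sub>v x + b))"

text \<open>
  Coordinates are numbered by the library's bijection between a finite type and an initial segment
  of the natural numbers. Another numbering permutes the columns of the first weight matrix and
  the rows of the last layer, which affects neither size nor depth.
\<close>

definition to_coords :: "real ^ 'n \<Rightarrow> real vec" where
  "to_coords x = Matrix.vec CARD('n) (\<lambda>i. vec_nth x (from_nat_into UNIV i))"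

definition of_coords :: "real vec \<Rightarrow> real ^ 'n" where
  "of_coords v = (\<chi> j. vec_index v (to_nat_on UNIV j))"

definition realize :: "relu_net \<Rightarrow> real ^ 'm \<Rightarrow> real ^ 'p" where
  "realize \<Phi> x = of_coords (realize_vec \<Phi> (to_coords x))"

definition nnz_mat :: "real mat \<Rightarrow> nat" where
  "nnz_mat A = card {(i, j). i < dim_row A \<and> j < dim_col A \<and> A $$ (i, j) \<noteq> 0}"

definition nnz_vec :: "real vec \<Rightarrow> nat" where
  "nnz_vec v = card {i. i < dim_vec v \<and> vec_index v i \<noteq> 0}"

definition net_size :: "relu_net \<Rightarrow> nat" where
  "net_size \<Phi> = (\<Sum>(W, b) \<leftarrow> \<Phi>. nnz_mat W + nnz_vec b)"

definition net_depth :: "relu_net \<Rightarrow> nat" where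
  "net_depth \<Phi> = length \<Phi> - 1"

text \<open>Topological support of a Borel measure.\<close>

definition msupp :: "'a::topological_space measure \<Rightarrow> 'a set" where
  "msupp M = {x. \<forall>U. open U \<longrightarrow> x \<in> U \<longrightarrow> emeasure M U > 0}"

text \<open>
  The norm of \<open>L\<^sup>2(K, M)\<close>. It is extended-valued, so that a function that is not square-integrable
  on \<open>K\<close> has norm \<open>\<infinity>\<close>. Values outside \<open>K\<close> are irrelevant.
\<close>

definition L2_norm_on :: "'a measure \<Rightarrow> 'a set \<Rightarrow> ('a \<Rightarrow> 'b::real_normed_vector) \<Rightarrow> ennreal" where
  "L2_norm_on M K f =
     (let I = \<integral>\<^sup>+x\<in>K. ennreal ((norm (f x))\<^sup>2) \<partial>M
      in if I = \<infinity> then \<infinity> else ennreal (sqrt (enn2real I)))"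

text \<open>\<open>|log r|\<^sup>-\<^sup>\<beta>\<close>, with value \<open>0\<close> at \<open>r = 0\<close>.\<close>

definition log_modulus :: "real \<Rightarrow> real \<Rightarrow> real" where
  "log_modulus \<beta> r = (if r = 0 then 0 else \<bar>ln r\<bar> powr (- \<beta>))"

text \<open>The best \<open>L\<^sup>2(K, M)\<close> error among ReLU networks of size at most \<open>N\<close>.\<close>

definition best_error ::
    "(real ^ 'm) measure \<Rightarrow> (real ^ 'm) set \<Rightarrow> (real ^ 'm \<Rightarrow> real ^ 'p) \<Rightarrow> nat \<Rightarrow> ennreal" where
  "best_error M K H N =
     (INF \<Phi> \<in> {\<Phi>. is_relu_net CARD('m) CARD('p) \<Phi> \<and> net_size \<Phi> \<le> N}.
        L2_norm_on M K (\<lambda>x. realize \<Phi> x - H x))"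

end

(*
  A composition of Lipschitz maps with G has a logarithmic modulus of continuity on K. Hence H is
  within eta/2 of a step function on a grid of half-open boxes whose side is of order
  exp(- A eta^(-1/beta)), and the number of boxes is its inverse m-th power. The L^2 norm allows the
  indicator of every box to be replaced by a network of fixed depth: the bump
  relu (1 - sum_i (relu (S (a_i - x_i)) + relu (S (x_i - b_i) + 1))) tends to the indicator of
  [a, b) pointwise as S tends to infinity, and the size of the weights does not enter the size
  of the network. The second part inverts the relation between eta and the size.
*)
theory Submission
  imports Defs
begin

section \<open>Half-open boxes and bump functions built from ramps\<close>

text \<open>Half-open, so that the cells of a grid do not overlap and every point lies in exactly
  one of them.\<close>

definition half_box :: "real ^ 'm \<Rightarrow> real ^ 'm \<Rightarrow> (real ^ 'm) set" where
  "half_box a b = {x. \<forall>i. vec_nth a i \<le> vec_nth x i \<and> vec_nth x i < vec_nth b i}"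

text \<open>Each summand penalizes one coordinate. The lower ramp is 0 at \<open>a\<close>, while
  the offset 1 makes the upper ramp equal to 1 at \<open>b\<close>: lower faces are kept and upper
  faces cut off, as in \<open>half_box\<close>.\<close>

definition box_bump :: "real \<Rightarrow> real ^ 'm \<Rightarrow> real ^ 'm \<Rightarrow> real ^ 'm \<Rightarrow> real" where
  "box_bump S a b x = relu (1 - (\<Sum>i\<in>UNIV. relu (S * (vec_nth a i - vec_nth x i)) +
     relu (S * (vec_nth x i - vec_nth b i) + 1)))"

lemma relu_nonneg: "0 \<le> relu x"
  by (simp add: relu_def)

lemma box_bump_nonneg: "0 \<le> box_bump S a b x"
  by (simp add: box_bump_def relu_nonneg)

lemma box_bump_le_1: "box_bump S a b x \<le> 1"
proof -
  have "0 \<le> (\<Sum>i\<in>UNIV. relu (S * (vec_nth a i - vec_nth x i)) +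
     relu (S * (vec_nth x i - vec_nth b i) + 1))"
    by (intro sum_nonneg add_nonneg_nonneg relu_nonneg)
  then show ?thesis by (simp add: box_bump_def relu_def)
qed

lemma continuous_on_box_bump: "continuous_on UNIV (box_bump S a b)"
  unfolding box_bump_def relu_def by (intro continuous_intros)

text \<open>All penalties are nonnegative, so a single coordinate with penalty at least 1 pushes the
  argument of the outer \<open>relu\<close> down to at most 0.\<close>

lemma box_bump_eq_0:
  assumes "1 \<le> relu (S * (vec_nth a i - vec_nth x i)) +
     relu (S * (vec_nth x i - vec_nth b i) + 1)"
  shows "box_bump S a b x = 0"
proof -
  let ?f = "\<lambda>i. relu (S * (vec_nth a i - vec_nth x i)) +
     relu (S * (vec_nth x i - vec_nth b i) + 1)"
  have "?f i \<le> sum ?f UNIV"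
    by (rule member_le_sum) (auto intro: add_nonneg_nonneg relu_nonneg)
  with assms show ?thesis by (simp add: box_bump_def relu_def)
qed

text \<open>At a fixed \<open>x\<close> the sequence is eventually constant. The threshold depends
  on the distance of \<open>x\<close> to a face, so the convergence is only pointwise, which
  suffices for dominated convergence.\<close>

lemma box_bump_tendsto:
  "(\<lambda>n. box_bump (real n) a b x) \<longlonglongrightarrow> indicat_real (half_box a b) x"
proof (rule tendsto_eventually)
  have large: "\<forall>\<^sub>F n in sequentially. 1 \<le> real n * c" if "0 < c" for c
  proof -
    have "\<forall>\<^sub>F n in sequentially. 1 / c \<le> real n"
      using filterlim_real_sequentially by (simp add: filterlim_at_top)
    then show ?thesis by eventually_elim (use that in \<open>simp add: field_simps\<close>)
  qed
  show "\<forall>\<^sub>F n in sequentially. box_bump (real n) a b x = indicat_real (half_box a b) x"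
  proof (cases "x \<in> half_box a b")
    case True
    have "\<forall>\<^sub>F n in sequentially. 1 \<le> real n * (vec_nth b i - vec_nth x i)" for i
      using True by (intro large) (simp add: half_box_def)
    then have "\<forall>\<^sub>F n in sequentially. \<forall>i. 1 \<le> real n * (vec_nth b i - vec_nth x i)"
      by (rule eventually_all_finite)
    then show ?thesis
    proof eventually_elim
      case (elim n)
      have "relu (real n * (vec_nth a i - vec_nth x i)) = 0" for i
        using True by (simp add: half_box_def relu_def mult_nonneg_nonpos)
      moreover have "relu (real n * (vec_nth x i - vec_nth b i) + 1) = 0" for i
        using elim[rule_format, of i] by (simp add: relu_def algebra_simps)
      ultimately show ?case using True by (simp add: box_bump_def relu_def)
    qed
  next
    case False
    then obtain i where i: "vec_nth x i < vec_nth a i \<or> vec_nth b i \<le> vec_nth x i"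
      by (auto simp: half_box_def not_le not_less)
    then show ?thesis
    proof
      assume "vec_nth x i < vec_nth a i"
      then have "\<forall>\<^sub>F n in sequentially. 1 \<le> real n * (vec_nth a i - vec_nth x i)"
        by (intro large) simp
      then show ?thesis
      proof eventually_elim
        case (elim n)
        have "1 \<le> relu (real n * (vec_nth a i - vec_nth x i))"
          using elim by (simp add: relu_def)
        then show ?case
          using False box_bump_eq_0[of "real n" a i x b] relu_nonneg
          by (simp add: add_increasing2)
      qed
    next
      assume le: "vec_nth b i \<le> vec_nth x i"
      \<comment> \<open>The offset 1 makes the upper penalty at least 1 for every \<open>n\<close>,
        also on the face itself.\<close>
      have "box_bump (real n) a b x = 0" for n
      proof (rule box_bump_eq_0)
        have "1 \<le> relu (real n * (vec_nth x i - vec_nth b i) + 1)"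
          using le by (simp add: relu_def)
        then show "1 \<le> relu (real n * (vec_nth a i - vec_nth x i)) +
            relu (real n * (vec_nth x i - vec_nth b i) + 1)"
          using relu_nonneg by (simp add: add_increasing)
      qed
      with False show ?thesis by simp
    qed
  qed
qed

section \<open>The network of boxes: its size and its realization\<close>

text \<open>
  Row \<open>r = 2mj + s\<close> of the first layer computes the ramp of box \<open>j\<close> at the lower end in
  coordinate \<open>s\<close> if \<open>s < m\<close>, and at the upper end in coordinate \<open>s - m\<close> otherwise.
\<close>

definition box_net ::
    "real \<Rightarrow> nat \<Rightarrow> (nat \<Rightarrow> real ^ 'm) \<Rightarrow> (nat \<Rightarrow> real ^ 'm) \<Rightarrow> (nat \<Rightarrow> real ^ 'p) \<Rightarrow> relu_net" where
  "box_net S n a b h = (let m = CARD('m); p = CARD('p) in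
     [(Matrix.mat (n * (2 * m)) m
         (\<lambda>(r, c). if c = r mod m then if r mod (2 * m) < m then - S else S else 0),
       Matrix.vec (n * (2 * m)) (\<lambda>r. if r mod (2 * m) < m
         then S * vec_nth (a (r div (2 * m))) (from_nat_into UNIV (r mod m))
         else 1 - S * vec_nth (b (r div (2 * m))) (from_nat_into UNIV (r mod m)))),
      (Matrix.mat n (n * (2 * m)) (\<lambda>(j, r). if r div (2 * m) = j then - 1 else 0),
       Matrix.vec n (\<lambda>_. 1)),
      (Matrix.mat p n (\<lambda>(q, j). vec_nth (h j) (from_nat_into UNIV q)),
       0\<^sub>v p)])"

lemma is_relu_net_box_net:
  fixes a b :: "nat \<Rightarrow> real ^ 'm" and h :: "nat \<Rightarrow> real ^ 'p"
  assumes "0 < n"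
  shows "is_relu_net CARD('m) CARD('p) (box_net S n a b h)"
  using assms by (simp add: box_net_def Let_def)

lemma net_depth_box_net: "net_depth (box_net S n a b h) = 2"
  by (simp add: box_net_def Let_def net_depth_def)

lemma nnz_vec_le: "nnz_vec v \<le> dim_vec v"
proof -
  have "card {i. i < dim_vec v \<and> vec_index v i \<noteq> 0} \<le> card {..<dim_vec v}"
    by (rule card_mono) auto
  then show ?thesis by (simp add: nnz_vec_def)
qed

text \<open>Counts a set of parameters that covers the nonzero positions, so that sparse matrices
  are not charged for all their entries.\<close>

lemma nnz_mat_le:
  assumes "finite B" and "\<And>i j. i < dim_row A \<Longrightarrow> j < dim_col A \<Longrightarrow> A $$ (i, j) \<noteq> 0 \<Longrightarrow> (i, j) \<in> f ` B"
  shows "nnz_mat A \<le> card B"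
proof -
  have "nnz_mat A \<le> card (f ` B)"
    unfolding nnz_mat_def using assms by (intro card_mono) auto
  also have "\<dots> \<le> card B" using assms(1) by (rule card_image_le)
  finally show ?thesis .
qed

text \<open>The first matrix has at most one nonzero entry per row and the second at most one per
  column; with the first bias this gives three times \<open>n * (2 * m)\<close>. The second bias
  adds \<open>n\<close> and the full last matrix \<open>p * n\<close>.\<close>

lemma net_size_box_net:
  fixes a b :: "nat \<Rightarrow> real ^ 'm" and h :: "nat \<Rightarrow> real ^ 'p"
  shows "net_size (box_net S n a b h) \<le> n * (6 * CARD('m) + 1 + CARD('p))"
proof -
  define m where "m = CARD('m)"
  define p where "p = CARD('p)"
  have 1: "nnz_mat (Matrix.mat (n * (2 * m)) m
         (\<lambda>(r, c). if c = r mod m then if r mod (2 * m) < m then - S else S else 0))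
       \<le> card {..<n * (2 * m)}"
    by (rule nnz_mat_le[where f = "\<lambda>r. (r, r mod m)"]) (auto split: if_splits)
  have 2: "nnz_mat (Matrix.mat n (n * (2 * m))
         (\<lambda>(j, r). if r div (2 * m) = j then - 1 else 0)) \<le> card {..<n * (2 * m)}"
    by (rule nnz_mat_le[where f = "\<lambda>r. (r div (2 * m), r)"]) (auto split: if_splits)
  have 3: "nnz_mat (Matrix.mat p n (\<lambda>(q, j). vec_nth (h j) (from_nat_into UNIV q)))
       \<le> card ({..<p} \<times> {..<n})"
    by (rule nnz_mat_le[where f = "\<lambda>x. x"]) auto
  have 4: "nnz_vec (Matrix.vec (n * (2 * m)) f) \<le> n * (2 * m)" for f
    using nnz_vec_le[of "Matrix.vec (n * (2 * m)) f"] by simp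
  have 5: "nnz_vec (Matrix.vec n f) \<le> n" for f
    using nnz_vec_le[of "Matrix.vec n f"] by simp
  have 6: "nnz_vec (0\<^sub>v p) = 0"
    by (simp add: nnz_vec_def)
  have "net_size (box_net S n a b h) \<le> n * (2 * m) + n * (2 * m) + ((n * (2 * m) + n) + ((p * n + 0) + 0))"
    unfolding box_net_def Let_def net_size_def m_def[symmetric] p_def[symmetric]
      list.map sum_list.Cons sum_list.Nil prod.case
    using 1 2 3 4 5 6 by (intro add_mono) simp_all
  also have "\<dots> = n * (6 * m + 1 + p)"
    by (simp add: algebra_simps)
  finally show ?thesis by (simp add: m_def p_def)
qed

text \<open>The left side is row \<open>j\<close> of the second weight matrix applied to a vector,
  with block length \<open>k\<close>; the index \<open>s\<close> is the offset inside block
  \<open>j\<close>.\<close>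

lemma sum_div_block:
  fixes f :: "nat \<Rightarrow> real"
  assumes "j < n" "0 < k"
  shows "(\<Sum>r = 0..<n * k. (if r div k = j then - 1 else 0) * f r) = - (\<Sum>s<k. f (j * k + s))"
proof -
  have lt: "j * k + s < n * k" if "s < k" for s
  proof -
    have "j * k + s < Suc j * k" using that by simp
    also have "\<dots> \<le> n * k" using assms(1) by (intro mult_le_mono1) simp
    finally show ?thesis .
  qed
  have "(\<Sum>r = 0..<n * k. (if r div k = j then - 1 else 0) * f r)
      = (\<Sum>r\<in>{r\<in>{0..<n * k}. r div k = j}. - f r)"
    by (subst sum.inter_filter) (auto intro: sum.cong)
  also have "\<dots> = (\<Sum>s<k. - f (j * k + s))"
    by (rule sum.reindex_bij_witness[where i = "\<lambda>s. j * k + s" and j = "\<lambda>r. r mod k"])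
      (use assms lt in auto)
  finally show ?thesis by (simp add: sum_negf)
qed

lemma sum_UNIV_from_nat_into:
  fixes f :: "'a::finite \<Rightarrow> 'b::comm_monoid_add"
  shows "(\<Sum>i<CARD('a). f (from_nat_into UNIV i)) = (\<Sum>i\<in>UNIV. f i)"
  by (rule sum.reindex_bij_betw) (rule bij_betw_from_nat_into_finite, simp)

text \<open>Pairs the lower and the upper ramp of the same coordinate inside one block of
  rows.\<close>

lemma sum_lessThan_double:
  fixes f :: "nat \<Rightarrow> 'b::comm_monoid_add"
  shows "(\<Sum>s<2 * m. f s) = (\<Sum>i<m. f i + f (m + i))"
proof -
  have "(\<Sum>s<2 * m. f s) = (\<Sum>s<m. f s) + (\<Sum>s = m..<m + m. f s)"
    using sum.atLeastLessThan_concat[of 0 m "m + m" f] by (simp add: lessThan_atLeast0 mult_2)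
  also have "(\<Sum>s = m..<m + m. f s) = (\<Sum>i<m. f (m + i))"
    using sum.shift_bounds_nat_ivl[of f 0 m m] by (simp add: lessThan_atLeast0 add.commute)
  finally show ?thesis by (simp add: sum.distrib)
qed

text \<open>The layers produce in turn all ramps, all bumps, and their linear combination with
  coefficients \<open>h j\<close>. The identity is exact, so the only error against a step function
  is that of bumps against indicators.\<close>

lemma realize_box_net:
  fixes a b :: "nat \<Rightarrow> real ^ 'm" and h :: "nat \<Rightarrow> real ^ 'p"
  shows "realize (box_net S n a b h) x = (\<Sum>j<n. box_bump S (a j) (b j) x *\<^sub>R h j)"
proof -
  define m where "m = CARD('m)"
  define p where "p = CARD('p)"
  have m: "0 < m" by (simp add: m_def)
  define W1 where "W1 = Matrix.mat (n * (2 * m)) m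
    (\<lambda>(r, c). if c = r mod m then if r mod (2 * m) < m then - S else S else 0)"
  define b1 where "b1 = Matrix.vec (n * (2 * m)) (\<lambda>r. if r mod (2 * m) < m
         then S * vec_nth (a (r div (2 * m))) (from_nat_into UNIV (r mod m))
         else 1 - S * vec_nth (b (r div (2 * m))) (from_nat_into UNIV (r mod m)))"
  define W2 :: "real mat" where
    "W2 = Matrix.mat n (n * (2 * m)) (\<lambda>(j, r). if r div (2 * m) = j then - 1 else 0)"
  define b2 :: "real vec" where "b2 = Matrix.vec n (\<lambda>_. 1)"
  define W3 where "W3 = Matrix.mat p n (\<lambda>(q, j). vec_nth (h j) (from_nat_into UNIV q))"
  define y1 where "y1 = map_vec relu (W1 *\<^sub>v to_coords x + b1)"
  define y2 where "y2 = map_vec relu (W2 *\<^sub>v y1 + b2)"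
  have dims: "dim_vec y1 = n * (2 * m)" "dim_vec y2 = n"
    by (simp_all add: y1_def y2_def W1_def W2_def b1_def b2_def)
  have y1: "vec_index y1 r =
      (if r mod (2 * m) < m
       then relu (S * (vec_nth (a (r div (2 * m))) (from_nat_into UNIV (r mod m))
                    - vec_nth x (from_nat_into UNIV (r mod m))))
       else relu (S * (vec_nth x (from_nat_into UNIV (r mod m))
                    - vec_nth (b (r div (2 * m))) (from_nat_into UNIV (r mod m))) + 1))"
    if r: "r < n * (2 * m)" for r
  proof -
    have "vec_index (W1 *\<^sub>v to_coords x) r =
      (\<Sum>c = 0..<m. (if c = r mod m then if r mod (2 * m) < m then - S else S else 0)
         * vec_nth x (from_nat_into UNIV c))"
      using r by (simp add: W1_def to_coords_def scalar_prod_def m_def[symmetric])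
    also have "\<dots> = (\<Sum>c = 0..<m. if r mod m = c then
        (if r mod (2 * m) < m then - S else S) * vec_nth x (from_nat_into UNIV c) else 0)"
      by (rule sum.cong) auto
    also have "\<dots> = (if r mod (2 * m) < m then - S else S) * vec_nth x (from_nat_into UNIV (r mod m))"
      using m by (subst sum.delta') auto
    finally have e: "vec_index (W1 *\<^sub>v to_coords x) r =
      (if r mod (2 * m) < m then - S else S) * vec_nth x (from_nat_into UNIV (r mod m))" .
    have "vec_index y1 r = relu (vec_index (W1 *\<^sub>v to_coords x) r + vec_index b1 r)"
      using r by (simp add: y1_def W1_def b1_def del: index_mult_mat_vec)
    then show ?thesis
      using r unfolding e by (simp add: b1_def algebra_simps)
  qed
  have y2: "vec_index y2 j = box_bump S (a j) (b j) x" if j: "j < n" for j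
  proof -
    let ?A = "\<lambda>i. relu (S * (vec_nth (a j) i - vec_nth x i))"
    let ?B = "\<lambda>i. relu (S * (vec_nth x i - vec_nth (b j) i) + 1)"
    have lt: "j * (2 * m) + s < n * (2 * m)" if "s < 2 * m" for s
    proof -
      have "j * (2 * m) + s < Suc j * (2 * m)" using that by simp
      also have "\<dots> \<le> n * (2 * m)" using j by (intro mult_le_mono1) simp
      finally show ?thesis .
    qed
    have lo: "vec_index y1 (j * (2 * m) + i) = ?A (from_nat_into UNIV i)" if "i < m" for i
    proof -
      have "(j * (2 * m) + i) mod m = i"
        using that by (metis mod_less mod_mult_self3 mult.assoc)
      moreover have "(j * (2 * m) + i) mod (2 * m) = i" "(j * (2 * m) + i) div (2 * m) = j"
        using that by auto
      ultimately show ?thesis using y1[OF lt, of i] that by simp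
    qed
    have hi: "vec_index y1 (j * (2 * m) + (m + i)) = ?B (from_nat_into UNIV i)" if "i < m" for i
    proof -
      \<comment> \<open>Written as a multiple of \<open>m\<close> plus \<open>i\<close>, so that the
        remainder modulo \<open>m\<close> is the coordinate number.\<close>
      have "j * (2 * m) + (m + i) = (2 * j + 1) * m + i" by (simp add: algebra_simps)
      then have "(j * (2 * m) + (m + i)) mod m = i"
        using that by (metis mod_less mod_mult_self3)
      moreover have "(j * (2 * m) + (m + i)) mod (2 * m) = m + i"
        "(j * (2 * m) + (m + i)) div (2 * m) = j"
        using that by auto
      ultimately show ?thesis using y1[OF lt, of "m + i"] that by simp
    qed
    have "vec_index (W2 *\<^sub>v y1) j =
        (\<Sum>r = 0..<n * (2 * m). (if r div (2 * m) = j then - 1 else 0) * vec_index y1 r)"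
      using j by (simp add: W2_def scalar_prod_def dims)
    also have "\<dots> = - (\<Sum>s<2 * m. vec_index y1 (j * (2 * m) + s))"
      using j m by (intro sum_div_block) auto
    also have "\<dots> = - (\<Sum>i<m. ?A (from_nat_into UNIV i) + ?B (from_nat_into UNIV i))"
      unfolding sum_lessThan_double using lo hi by simp
    also have "\<dots> = - (\<Sum>i\<in>UNIV. ?A i + ?B i)"
      unfolding m_def by (subst sum_UNIV_from_nat_into) simp
    finally have e: "vec_index (W2 *\<^sub>v y1) j = - (\<Sum>i\<in>UNIV. ?A i + ?B i)" .
    have "vec_index y2 j = relu (vec_index (W2 *\<^sub>v y1) j + 1)"
      using j by (simp add: y2_def W2_def b2_def del: index_mult_mat_vec)
    then show ?thesis unfolding e box_bump_def by simp
  qed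
  have "realize_vec (box_net S n a b h) (to_coords x) = W3 *\<^sub>v y2 + 0\<^sub>v p"
    unfolding box_net_def Let_def y1_def y2_def W1_def W2_def W3_def b1_def b2_def m_def p_def
      realize_vec.simps by (rule refl)
  then have r: "realize (box_net S n a b h) x = of_coords (W3 *\<^sub>v y2 + 0\<^sub>v p)"
    by (simp add: realize_def)
  show ?thesis
  proof (rule Finite_Cartesian_Product.vec_eq_iff[THEN iffD2, rule_format])
    fix q :: 'p
    \<comment> \<open>Coordinate \<open>q\<close> sits in row \<open>to_nat_on UNIV q\<close>, which
      \<open>from_nat_into\<close> sends back to \<open>q\<close>.\<close>
    have q: "to_nat_on UNIV q < p"
      using bij_betw_apply[OF to_nat_on_finite, of UNIV q] by (simp add: p_def)
    have "vec_nth (realize (box_net S n a b h) x) q = (\<Sum>j = 0..<n. vec_nth (h j) q * vec_index y2 j)"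
      using q by (simp add: r of_coords_def W3_def scalar_prod_def dims)
    also have "\<dots> = (\<Sum>j<n. box_bump S (a j) (b j) x * vec_nth (h j) q)"
      by (rule sum.cong) (auto simp: y2)
    finally show "vec_nth (realize (box_net S n a b h) x) q =
        vec_nth (\<Sum>j<n. box_bump S (a j) (b j) x *\<^sub>R h j) q"
      by simp
  qed
qed

section \<open>Approximation of step functions in mean square\<close>

text \<open>Dominated convergence along integer slopes: bumps and indicators lie in [0, 1], so the
  integrand is bounded by a constant, which is integrable for a probability measure. Measurability
  of the difference is stated as well, for splitting integrals later.\<close>

lemma box_net_L2_approx:
  fixes a b :: "nat \<Rightarrow> real ^ 'm" and h :: "nat \<Rightarrow> real ^ 'p"
  assumes "prob_space M" and sets: "sets M = sets borel" and "0 < \<epsilon>"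
  obtains S where
    "(\<lambda>x. realize (box_net S n a b h) x - (\<Sum>j<n. indicat_real (half_box (a j) (b j)) x *\<^sub>R h j))
        \<in> borel_measurable M"
    "(\<integral>\<^sup>+x. ennreal ((norm (realize (box_net S n a b h) x -
        (\<Sum>j<n. indicat_real (half_box (a j) (b j)) x *\<^sub>R h j)))\<^sup>2) \<partial>M) \<le> ennreal \<epsilon>"
proof -
  interpret prob_space M by fact
  define f where "f k x = (\<Sum>j<n. box_bump (real k) (a j) (b j) x *\<^sub>R h j)" for k x
  define g where "g x = (\<Sum>j<n. indicat_real (half_box (a j) (b j)) x *\<^sub>R h j)" for x
  have lim: "(\<lambda>k. f k x) \<longlonglongrightarrow> g x" for x
    unfolding f_def g_def by (intro tendsto_intros box_bump_tendsto)
  have "continuous_on UNIV (f k)" for k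
    unfolding f_def
    by (intro continuous_intros continuous_on_compose2[OF continuous_on_box_bump]) auto
  then have fm: "f k \<in> borel_measurable M" for k
    unfolding measurable_cong_sets[OF sets refl] by (rule borel_measurable_continuous_onI)
  \<comment> \<open>The step function is measurable as a pointwise limit of continuous
    functions.\<close>
  have gm: "g \<in> borel_measurable M"
    using lim fm by (rule borel_measurable_LIMSEQ_metric[rotated])
  have bound: "norm (f k x - g x) \<le> (\<Sum>j<n. norm (h j))" for k x
  proof -
    have "f k x - g x = (\<Sum>j<n. (box_bump (real k) (a j) (b j) x
        - indicat_real (half_box (a j) (b j)) x) *\<^sub>R h j)"
      by (simp add: f_def g_def sum_subtractf scaleR_diff_left)
    also have "norm \<dots> \<le> (\<Sum>j<n. norm (h j))"
    proof (rule sum_norm_le)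
      fix j
      have "\<bar>box_bump (real k) (a j) (b j) x - indicat_real (half_box (a j) (b j)) x\<bar> \<le> 1"
        using box_bump_nonneg[of "real k" "a j" "b j" x] box_bump_le_1[of "real k" "a j" "b j" x]
        by (auto simp: indicator_def)
      then show "norm ((box_bump (real k) (a j) (b j) x
          - indicat_real (half_box (a j) (b j)) x) *\<^sub>R h j) \<le> norm (h j)"
        by (simp add: mult_left_le_one_le)
    qed
    finally show ?thesis .
  qed
  have dm: "(\<lambda>x. (norm (f k x - g x))\<^sup>2) \<in> borel_measurable M" for k
    using fm gm by measurable
  have sqlim: "(\<lambda>k. (norm (f k x - g x))\<^sup>2) \<longlonglongrightarrow> 0" for x
  proof -
    have "(\<lambda>k. (norm (f k x - g x))\<^sup>2) \<longlonglongrightarrow> (norm (g x - g x))\<^sup>2"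
      by (intro tendsto_intros lim)
    then show ?thesis by simp
  qed
  have sqb: "(norm (f k x - g x))\<^sup>2 \<le> (\<Sum>j<n. norm (h j))\<^sup>2" for k x
    using bound by (intro power_mono) auto
  have int: "integrable M (\<lambda>x. (norm (f k x - g x))\<^sup>2)" for k
    using dm sqb by (intro integrable_const_bound[where B = "(\<Sum>j<n. norm (h j))\<^sup>2"]) auto
  have "(\<lambda>k. \<integral>x. (norm (f k x - g x))\<^sup>2 \<partial>M) \<longlonglongrightarrow> (\<integral>x. 0 \<partial>M)"
    by (rule integral_dominated_convergence[where w = "\<lambda>_. (\<Sum>j<n. norm (h j))\<^sup>2"])
      (use dm sqlim sqb in auto)
  then have "\<forall>\<^sub>F k in sequentially. (\<integral>x. (norm (f k x - g x))\<^sup>2 \<partial>M) < \<epsilon>"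
    using \<open>0 < \<epsilon>\<close> by (auto dest: order_tendstoD)
  then obtain k where k: "(\<integral>x. (norm (f k x - g x))\<^sup>2 \<partial>M) < \<epsilon>"
    by (auto simp: eventually_sequentially)
  have eq: "realize (box_net (real k) n a b h) x - (\<Sum>j<n. indicat_real (half_box (a j) (b j)) x *\<^sub>R h j)
      = f k x - g x" for x
    by (simp add: realize_box_net f_def g_def)
  show ?thesis
  proof (rule that[of "real k"])
    show "(\<integral>\<^sup>+x. ennreal ((norm (realize (box_net (real k) n a b h) x -
        (\<Sum>j<n. indicat_real (half_box (a j) (b j)) x *\<^sub>R h j)))\<^sup>2) \<partial>M) \<le> ennreal \<epsilon>"
      unfolding eq using k int by (subst nn_integral_eq_integral) (auto intro: ennreal_leI)
    show "(\<lambda>x. realize (box_net (real k) n a b h) x -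
        (\<Sum>j<n. indicat_real (half_box (a j) (b j)) x *\<^sub>R h j)) \<in> borel_measurable M"
      unfolding eq using fm gm by measurable
  qed
qed

lemma L2_norm_on_le:
  assumes "(\<integral>\<^sup>+x\<in>K. ennreal ((norm (f x))\<^sup>2) \<partial>M) \<le> ennreal (\<eta>\<^sup>2)" "0 \<le> \<eta>"
  shows "L2_norm_on M K f \<le> ennreal \<eta>"
proof -
  let ?I = "\<integral>\<^sup>+x\<in>K. ennreal ((norm (f x))\<^sup>2) \<partial>M"
  have fin: "?I \<noteq> \<infinity>"
    using assms(1) by (auto simp: top_unique)
  have "enn2real ?I \<le> \<eta>\<^sup>2"
    using enn2real_mono[OF assms(1)] by simp
  then have "sqrt (enn2real ?I) \<le> \<eta>"
    using real_le_lsqrt assms(2) by simp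
  with fin show ?thesis
    by (simp add: L2_norm_on_def Let_def ennreal_leI)
qed

section \<open>Approximation on a grid of half-open boxes\<close>

text \<open>In each coordinate this is the characterization of the floor by two inequalities. The
  lower bound on \<open>x\<close> makes the floor nonnegative, so \<open>nat\<close> loses
  nothing.\<close>

lemma half_box_grid_iff:
  fixes x :: "real ^ 'm" and k :: "'m \<Rightarrow> nat"
  assumes "0 < s" and "\<And>i. - R \<le> vec_nth x i"
  shows "x \<in> half_box (\<chi> i. - R + s * real (k i)) (\<chi> i. - R + s * (real (k i) + 1))
    \<longleftrightarrow> k = (\<lambda>i. nat \<lfloor>(vec_nth x i + R) / s\<rfloor>)"
proof -
  have "- R + s * real (k i) \<le> vec_nth x i \<and> vec_nth x i < - R + s * (real (k i) + 1)
      \<longleftrightarrow> k i = nat \<lfloor>(vec_nth x i + R) / s\<rfloor>" for i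
  proof -
    let ?t = "(vec_nth x i + R) / s"
    have "0 \<le> vec_nth x i + R" using assms(2)[of i] by simp
    then have t: "0 \<le> ?t" using assms(1) by simp
    have "- R + s * real (k i) \<le> vec_nth x i \<and> vec_nth x i < - R + s * (real (k i) + 1)
      \<longleftrightarrow> of_int (int (k i)) \<le> ?t \<and> ?t < of_int (int (k i)) + 1"
      using assms(1) by (auto simp: field_simps)
    also have "\<dots> \<longleftrightarrow> \<lfloor>?t\<rfloor> = int (k i)"
      by (auto simp: floor_eq_iff)
    also have "\<dots> \<longleftrightarrow> k i = nat \<lfloor>?t\<rfloor>"
      using t by (auto simp: nat_eq_iff2)
    finally show ?thesis .
  qed
  then show ?thesis by (auto simp: half_box_def fun_eq_iff)
qed

text \<open>The l1 norm dominates the Euclidean one. The factor \<open>CARD('m)\<close> in place of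
  its square root only changes constants.\<close>

lemma norm_diff_half_box_le:
  fixes x y a b :: "real ^ 'm"
  assumes "x \<in> half_box a b" "y \<in> half_box a b" "\<And>i. vec_nth b i - vec_nth a i \<le> s"
  shows "norm (x - y) \<le> real CARD('m) * s"
proof -
  have "norm (x - y) \<le> (\<Sum>i\<in>UNIV. \<bar>vec_nth (x - y) i\<bar>)"
    by (rule norm_le_l1_cart)
  also have "\<dots> \<le> (\<Sum>i\<in>(UNIV :: 'm set). s)"
  proof (rule sum_mono)
    fix i
    have "vec_nth a i \<le> vec_nth x i" "vec_nth x i < vec_nth b i"
      "vec_nth a i \<le> vec_nth y i" "vec_nth y i < vec_nth b i"
      using assms(1,2) by (auto simp: half_box_def)
    with assms(3)[of i] show "\<bar>vec_nth (x - y) i\<bar> \<le> s"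
      by simp
  qed
  finally show ?thesis by simp
qed

text \<open>On \<open>K\<close> the function \<open>H\<close> differs by at most
  \<open>\<eta> / 2\<close> from a step function that is constant on the \<open>M ^ CARD('m)\<close>
  cells of side \<open>2 * R / M\<close>; the network then replaces the step function with a small
  mean square error.\<close>

lemma relu_net_approx_grid:
  fixes K :: "(real ^ 'm) set" and H :: "real ^ 'm \<Rightarrow> real ^ 'p"
  assumes "prob_space \<nu>" and "sets \<nu> = sets borel"
    and R: "0 < R" "\<And>x i. x \<in> K \<Longrightarrow> \<bar>vec_nth x i\<bar> < R"
    and "0 < M" and "0 < \<eta>"
    and osc: "\<And>x y. x \<in> K \<Longrightarrow> y \<in> K \<Longrightarrow> norm (x - y) \<le> real CARD('m) * (2 * R / real M) \<Longrightarrow>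
      norm (H x - H y) \<le> \<eta> / 2"
  obtains \<Phi> where "is_relu_net CARD('m) CARD('p) \<Phi>"
    "L2_norm_on \<nu> K (\<lambda>x. realize \<Phi> x - H x) \<le> ennreal \<eta>"
    "net_size \<Phi> \<le> M ^ CARD('m) * (6 * CARD('m) + 1 + CARD('p))" "net_depth \<Phi> = 2"
proof -
  interpret prob_space \<nu> by fact
  define s where "s = 2 * R / real M"
  have s: "0 < s" using R \<open>0 < M\<close> by (simp add: s_def)
  define cells :: "('m \<Rightarrow> nat) set" where "cells = PiE UNIV (\<lambda>_. {..<M})"
  define n where "n = M ^ CARD('m)"
  have cells: "finite cells" "card cells = n"
    by (simp_all add: cells_def n_def card_PiE finite_PiE)
  then obtain e where e: "bij_betw e {0..<n} cells"
    using ex_bij_betw_nat_finite by blast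
  define a where "a j = (\<chi> i. - R + s * real (e j i))" for j
  define b where "b j = (\<chi> i. - R + s * (real (e j i) + 1))" for j
  \<comment> \<open>The sample point is taken in \<open>K\<close>, where the oscillation of
    \<open>H\<close> is controlled. For a cell that misses \<open>K\<close> the choice is arbitrary,
    but such a cell does not enter the error on \<open>K\<close>.\<close>
  define h where "h j = H (SOME y. y \<in> K \<inter> half_box (a j) (b j))" for j
  define g where "g x = (\<Sum>j<n. indicat_real (half_box (a j) (b j)) x *\<^sub>R h j)" for x
  have gH: "norm (g x - H x) \<le> \<eta> / 2" if x: "x \<in> K" for x
  proof -
    have lb: "- R \<le> vec_nth x i" and ub: "vec_nth x i < R" for i
      using R(2)[OF x, of i] by auto
    define k where "k = (\<lambda>i. nat \<lfloor>(vec_nth x i + R) / s\<rfloor>)"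
    \<comment> \<open>Strictness of the bound \<open>R\<close> matters: a coordinate equal to
      \<open>R\<close> would have index \<open>M\<close>, just outside the grid.\<close>
    have "k i < M" for i
    proof -
      have "(vec_nth x i + R) / s < 2 * R / s"
        using ub[of i] s by (intro divide_strict_right_mono) auto
      also have "2 * R / s = real M"
        using R \<open>0 < M\<close> by (simp add: s_def)
      finally have "\<lfloor>(vec_nth x i + R) / s\<rfloor> < int M"
        by (simp add: floor_less_iff)
      then show ?thesis using \<open>0 < M\<close> by (simp add: k_def)
    qed
    then have "k \<in> cells" by (auto simp: cells_def PiE_UNIV_domain)
    then obtain j where j: "j < n" "e j = k"
      using e by (auto simp: bij_betw_def image_iff)
    have iff: "x \<in> half_box (a j') (b j') \<longleftrightarrow> j' = j" if "j' < n" for j'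
    proof -
      have "x \<in> half_box (a j') (b j') \<longleftrightarrow> e j' = k"
        unfolding a_def b_def k_def by (rule half_box_grid_iff[OF s lb])
      also have "\<dots> \<longleftrightarrow> j' = j"
        using e j that by (auto simp: bij_betw_def inj_on_def)
      finally show ?thesis .
    qed
    have "g x = (\<Sum>j'<n. if j' = j then h j' else 0)"
      unfolding g_def by (rule sum.cong) (auto simp: iff)
    then have g: "g x = h j" using j by simp
    let ?y = "SOME y. y \<in> K \<inter> half_box (a j) (b j)"
    have xb: "x \<in> half_box (a j) (b j)" using iff j by simp
    have y: "?y \<in> K \<inter> half_box (a j) (b j)"
      by (rule someI[of "\<lambda>y. y \<in> K \<inter> half_box (a j) (b j)" x]) (use x xb in simp)
    have "norm (?y - x) \<le> real CARD('m) * s"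
      using y xb by (intro norm_diff_half_box_le[of _ "a j" "b j"])
        (auto simp: a_def b_def algebra_simps)
    then show ?thesis
      unfolding g h_def using x y by (intro osc) (auto simp: s_def)
  qed
  \<comment> \<open>With \<open>u\<close> the error of the network against \<open>g\<close>, the
    square of \<open>u + \<eta> / 2\<close> is at most \<open>2 * u^2 + \<eta>^2 / 2\<close>; a
    tolerance of \<open>\<eta>^2 / 4\<close> for the integral of \<open>u^2\<close> makes the total
    \<open>\<eta>^2\<close>.\<close>
  have "0 < \<eta>\<^sup>2 / 4" using \<open>0 < \<eta>\<close> by simp
  from box_net_L2_approx[OF assms(1,2) this, of n a b h, folded g_def]
  obtain S where Sm: "(\<lambda>x. realize (box_net S n a b h) x - g x) \<in> borel_measurable \<nu>"
    and S: "(\<integral>\<^sup>+x. ennreal ((norm (realize (box_net S n a b h) x - g x))\<^sup>2) \<partial>\<nu>) \<le> ennreal (\<eta>\<^sup>2 / 4)"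
    by blast
  define F :: "real ^ 'm \<Rightarrow> real ^ 'p" where "F = realize (box_net S n a b h)"
  show ?thesis
  proof (rule that)
    show "is_relu_net CARD('m) CARD('p) (box_net S n a b h)"
      using \<open>0 < M\<close> by (intro is_relu_net_box_net) (simp add: n_def)
    show "net_size (box_net S n a b h) \<le> M ^ CARD('m) * (6 * CARD('m) + 1 + CARD('p))"
      using net_size_box_net[of S n a b h] by (simp add: n_def)
    show "net_depth (box_net S n a b h) = 2"
      by (rule net_depth_box_net)
    \<comment> \<open>Monotonicity holds for arbitrary integrands, so \<open>H\<close> is eliminated
      before the integral is split, where measurability enters.\<close>
    have "(\<integral>\<^sup>+x\<in>K. ennreal ((norm (F x - H x))\<^sup>2) \<partial>\<nu>)
        \<le> (\<integral>\<^sup>+x. ennreal (\<eta>\<^sup>2 / 2) + ennreal 2 * ennreal ((norm (F x - g x))\<^sup>2) \<partial>\<nu>)"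
    proof (rule nn_integral_mono)
      fix x
      show "ennreal ((norm (F x - H x))\<^sup>2) * indicator K x
          \<le> ennreal (\<eta>\<^sup>2 / 2) + ennreal 2 * ennreal ((norm (F x - g x))\<^sup>2)"
      proof (cases "x \<in> K")
        case True
        have "norm (F x - H x) \<le> norm (F x - g x) + \<eta> / 2"
          using norm_triangle_ineq[of "F x - g x" "g x - H x"] gH[OF True] by simp
        then have "(norm (F x - H x))\<^sup>2 \<le> (norm (F x - g x) + \<eta> / 2)\<^sup>2"
          by (intro power_mono) auto
        also have "\<dots> \<le> \<eta>\<^sup>2 / 2 + 2 * (norm (F x - g x))\<^sup>2"
          using zero_le_power2[of "norm (F x - g x) - \<eta> / 2"]
          by (simp add: power2_eq_square algebra_simps)
        finally have "ennreal ((norm (F x - H x))\<^sup>2)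
            \<le> ennreal (\<eta>\<^sup>2 / 2 + 2 * (norm (F x - g x))\<^sup>2)"
          by (rule ennreal_leI)
        also have "\<dots> = ennreal (\<eta>\<^sup>2 / 2) + ennreal 2 * ennreal ((norm (F x - g x))\<^sup>2)"
          by (subst ennreal_plus) (auto simp: ennreal_mult)
        finally show ?thesis using True by simp
      qed simp
    qed
    also have "\<dots> = ennreal (\<eta>\<^sup>2 / 2) + ennreal 2 * (\<integral>\<^sup>+x. ennreal ((norm (F x - g x))\<^sup>2) \<partial>\<nu>)"
      using Sm unfolding F_def[symmetric]
      by (subst nn_integral_add) (auto simp: nn_integral_cmult emeasure_space_1)
    also have "\<dots> \<le> ennreal (\<eta>\<^sup>2 / 2) + ennreal 2 * ennreal (\<eta>\<^sup>2 / 4)"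
      using S unfolding F_def[symmetric] by (intro add_left_mono mult_left_mono) auto
    also have "\<dots> = ennreal (\<eta>\<^sup>2 / 2 + 2 * (\<eta>\<^sup>2 / 4))"
      by (subst ennreal_mult[symmetric]; simp flip: ennreal_plus)
    also have "\<eta>\<^sup>2 / 2 + 2 * (\<eta>\<^sup>2 / 4) = \<eta>\<^sup>2"
      by simp
    finally show "L2_norm_on \<nu> K (\<lambda>x. realize (box_net S n a b h) x - H x) \<le> ennreal \<eta>"
      unfolding F_def using \<open>0 < \<eta>\<close> by (intro L2_norm_on_le) auto
  qed
qed

section \<open>Logarithmic modulus, choice of constants, and inversion of the size bound\<close>

text \<open>The modulus is increasing on [0, 1), and \<open>E powr (- \<beta>)\<close> is its value
  at \<open>exp (- E)\<close>.\<close>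

lemma log_modulus_le:
  assumes "0 < \<beta>" "0 \<le> t" "0 < E" "t \<le> exp (- E)"
  shows "log_modulus \<beta> t \<le> E powr (- \<beta>)"
proof (cases "t = 0")
  case False
  then have "ln t \<le> - E"
    using assms ln_le_cancel_iff[of t "exp (- E)"] by simp
  then have "\<bar>ln t\<bar> powr (- \<beta>) \<le> E powr (- \<beta>)"
    using assms by (intro powr_mono2') auto
  with False show ?thesis by (simp add: log_modulus_def)
qed (simp add: log_modulus_def)

theorem theorem2p2:
  fixes DG :: "'x::{real_inner, complete_space} set"
    and G :: "'x \<Rightarrow> 'y::{real_inner, complete_space}"
    and Cstab \<beta> \<tau> :: real
    and \<mu> :: "'x measure"
    and Enc :: "'x \<Rightarrow> real ^ 'm"
    and Dec :: "real ^ 'm \<Rightarrow> 'x"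
    and P :: "'y \<Rightarrow> real ^ 'p"
    and \<nu> :: "(real ^ 'm) measure"
    and K :: "(real ^ 'm) set"
    and H :: "real ^ 'm \<Rightarrow> real ^ 'p"
  assumes "separable_space (euclidean :: 'x topology)"
    and "separable_space (euclidean :: 'y topology)"
    and "closed DG" and "continuous_on DG G"
    and "Cstab > 0" and "0 < \<beta>" and "\<beta> < 1" and "0 < \<tau>" and "\<tau> < 1"
    and "\<And>x1 x2. x1 \<in> DG \<Longrightarrow> x2 \<in> DG \<Longrightarrow> norm (x1 - x2) \<le> \<tau> \<Longrightarrow>
           norm (G x1 - G x2) \<le> Cstab * log_modulus \<beta> (norm (x1 - x2))"
    and "prob_space \<mu>" and "sets \<mu> = sets borel" and "emeasure \<mu> DG = 1"
    and "integrable \<mu> (\<lambda>x. (norm x)\<^sup>2)"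
    and "Enc \<in> borel_measurable borel"
    and "\<exists>L. L-lipschitz_on UNIV Dec" and "\<exists>L. L-lipschitz_on UNIV P"
    and "\<nu> = distr \<mu> borel Enc" and "K = msupp \<nu>"
    and "compact K" and "Dec ` K \<subseteq> DG"
    and "\<And>x. x \<in> K \<Longrightarrow> H x = P (G (Dec x))"
  shows "\<exists>c0 c1 c2 c3 :: real. c0 > 0 \<and> c1 > 0 \<and> c2 > 0 \<and> c3 > 0 \<and>
    (\<forall>\<eta>::real. 0 < \<eta> \<longrightarrow> \<eta> < 1 \<longrightarrow>
      (\<exists>\<Phi>. is_relu_net CARD('m) CARD('p) \<Phi> \<and>
        L2_norm_on \<nu> K (\<lambda>x. realize \<Phi> x - H x) \<le> ennreal \<eta> \<and>
        real (net_size \<Phi>)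
          \<le> c0 * (real CARD('p) + 1) * exp (c1 * real CARD('m) * \<eta> powr (- 1 / \<beta>)) \<and>
        real (net_depth \<Phi>) \<le> c2 + c3 * real CARD('m) * \<eta> powr (- 1 / \<beta>))) \<and>
    (\<forall>N::nat. real N > c0 * (real CARD('p) + 1) * exp (c1 * real CARD('m)) \<longrightarrow>
      best_error \<nu> K H N
        \<le> ennreal ((1 / (c1 * real CARD('m)) * ln (real N / (c0 * (real CARD('p) + 1))))
                    powr (- \<beta>)))"
proof -
  note Cpos = assms(5) and \<beta> = assms(6) and \<tau> = assms(8,9) and stab = assms(10)
  interpret prob_space \<mu> by fact
  have Enc: "Enc \<in> \<mu> \<rightarrow>\<^sub>M borel"
    using assms(15) assms(12) by (simp cong: measurable_cong_sets)
  have \<nu>: "prob_space \<nu>" "sets \<nu> = sets borel"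
    using Enc by (simp_all add: assms(18) prob_space_distr)
  obtain LD where LD: "LD-lipschitz_on UNIV Dec" using assms(16) by blast
  obtain LP where LP: "LP-lipschitz_on UNIV P" using assms(17) by blast
  have LD0: "0 \<le> LD" and LP0: "0 \<le> LP"
    using LD LP lipschitz_on_nonneg by blast+
  obtain R where R: "0 < R" "\<And>x. x \<in> K \<Longrightarrow> norm x < R"
    using compact_imp_bounded[OF assms(20)] by (auto simp: bounded_pos_less)
  have Rc: "\<bar>vec_nth x i\<bar> < R" if "x \<in> K" for x i
    using component_le_norm_cart[of x i] R(2)[OF that] by simp
  define m where "m = real CARD('m)"
  define p where "p = real CARD('p)"
  have m: "1 \<le> m" and p: "1 \<le> p"
    by (simp_all add: m_def p_def Suc_leI)
  \<comment> \<open>The first summand brings the modulus of \<open>H\<close> down to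
    \<open>\<eta> / 2\<close>; the second forces \<open>exp (- (A * E)) \<le> \<tau>\<close>, so
    that the stability estimate applies. Adding 1 to the Lipschitz constants keeps \<open>A\<close>
    and \<open>B\<close> positive even if these vanish.\<close>
  define A where "A = (2 * Cstab * (LP + 1)) powr (1 / \<beta>) + \<bar>ln \<tau>\<bar>"
  \<comment> \<open>With \<open>M \<ge> B * exp (A * E)\<close> intervals per axis,
    \<open>Dec\<close> maps points of \<open>K\<close> in one cell to points at distance at most
    \<open>B / M \<le> exp (- (A * E))\<close>.\<close>
  define B where "B = (LD + 1) * (m * (2 * R)) "
  have A: "0 < A"
    using Cpos LP0 unfolding A_def by (intro add_pos_nonneg) auto
  have B: "0 < B"
    using LD0 m R by (simp add: B_def)
  \<comment> \<open>The power comes from \<open>M \<le> (B + 1) * exp (A * E)\<close>, the other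
    factor from \<open>6 * m + 1 + p \<le> (6 * m + 1) * (p + 1)\<close>.\<close>
  define c0 where "c0 = (B + 1) ^ CARD('m) * (6 * m + 1)"
  have c0: "0 < c0" using B m by (simp add: c0_def)
  have main: "\<exists>\<Phi>. is_relu_net CARD('m) CARD('p) \<Phi> \<and>
        L2_norm_on \<nu> K (\<lambda>x. realize \<Phi> x - H x) \<le> ennreal \<eta> \<and>
        real (net_size \<Phi>) \<le> c0 * (p + 1) * exp (A * m * \<eta> powr (- 1 / \<beta>)) \<and>
        real (net_depth \<Phi>) \<le> 2 + 1 * m * \<eta> powr (- 1 / \<beta>)"
    if \<eta>: "0 < \<eta>" "\<eta> < 1" for \<eta>
  proof -
    define E where "E = \<eta> powr (- 1 / \<beta>)"
    have "\<eta> powr 0 \<le> \<eta> powr (- 1 / \<beta>)"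
      using \<eta> \<beta> by (intro powr_mono') auto
    then have E1: "1 \<le> E"
      using \<eta> by (simp add: E_def)
    have tau: "exp (- (A * E)) \<le> \<tau>"
    proof -
      \<comment> \<open>Here \<open>\<eta> < 1\<close> enters, through
        \<open>E \<ge> 1\<close>.\<close>
      have "\<bar>ln \<tau>\<bar> * 1 \<le> A * E"
        using E1 A by (intro mult_mono) (auto simp: A_def)
      then have "exp (- (A * E)) \<le> exp (ln \<tau>)" by simp
      then show ?thesis using \<tau> by simp
    qed
    have AE: "Cstab * (A * E) powr (- \<beta>) * (LP + 1) \<le> \<eta> / 2"
    proof -
      define D where "D = 2 * Cstab * (LP + 1)"
      have D: "0 < D" using Cpos LP0 by (simp add: D_def)
      have "(D powr (1 / \<beta>)) powr (- \<beta>) = 1 / D"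
        using \<beta> D by (simp add: powr_powr powr_minus_divide)
      moreover have "E powr (- \<beta>) = \<eta>"
        using \<beta> \<eta> by (simp add: E_def powr_powr)
      ultimately have "(D powr (1 / \<beta>) * E) powr (- \<beta>) = \<eta> / D"
        using E1 by (simp add: powr_mult)
      \<comment> \<open>The exponent is negative, so dropping the summand
        \<open>\<bar>ln \<tau>\<bar>\<close> of \<open>A\<close> enlarges the power.\<close>
      moreover have "(A * E) powr (- \<beta>) \<le> (D powr (1 / \<beta>) * E) powr (- \<beta>)"
      proof (rule powr_mono2')
        show "0 < D powr (1 / \<beta>) * E" using D E1 by simp
        show "D powr (1 / \<beta>) * E \<le> A * E"
          using E1 by (intro mult_right_mono) (auto simp: A_def D_def)
      qed (use \<beta> in simp)
      ultimately have "(A * E) powr (- \<beta>) \<le> \<eta> / D" by simp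
      then have "(A * E) powr (- \<beta>) * (Cstab * (LP + 1)) \<le> \<eta> / D * (Cstab * (LP + 1))"
        using Cpos LP0 by (intro mult_right_mono) auto
      also have "\<dots> = \<eta> / 2"
        using D Cpos LP0 by (simp add: D_def field_simps)
      finally show ?thesis by (simp add: algebra_simps)
    qed
    define M where "M = nat \<lceil>B * exp (A * E)\<rceil>"
    have M: "B * exp (A * E) \<le> real M" "real M \<le> B * exp (A * E) + 1"
      unfolding M_def using B of_nat_ceiling[of "B * exp (A * E)"]
        of_int_ceiling_le_add_one[of "B * exp (A * E)"] by simp_all
    have "0 < B * exp (A * E)" using B by simp
    then have M0: "0 < M" using M by linarith
    have osc: "norm (H x - H y) \<le> \<eta> / 2"
      if xy: "x \<in> K" "y \<in> K" and d: "norm (x - y) \<le> real CARD('m) * (2 * R / real M)" for x y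
    proof -
      let ?t = "norm (Dec x - Dec y)"
      have "?t \<le> LD * norm (x - y)"
        using LD by (auto simp: lipschitz_on_def dist_norm)
      also have "\<dots> \<le> (LD + 1) * (m * (2 * R / real M))"
        using d LD0 by (intro mult_mono) (auto simp: m_def)
      also have "\<dots> = B / real M"
        by (simp add: B_def)
      also have "\<dots> \<le> exp (- (A * E))"
        using M(1) M0 by (simp add: exp_minus field_simps)
      finally have t: "?t \<le> exp (- (A * E))" .
      have in_DG: "Dec x \<in> DG" "Dec y \<in> DG" using xy assms(21) by auto
      have "norm (G (Dec x) - G (Dec y)) \<le> Cstab * log_modulus \<beta> ?t"
        using t tau in_DG by (intro stab) auto
      also have "\<dots> \<le> Cstab * (A * E) powr (- \<beta>)"
        using t Cpos \<beta> A E1 by (intro mult_left_mono log_modulus_le) auto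
      finally have G: "norm (G (Dec x) - G (Dec y)) \<le> Cstab * (A * E) powr (- \<beta>)" .
      have "norm (H x - H y) \<le> LP * norm (G (Dec x) - G (Dec y))"
        using LP xy assms(22) by (auto simp: lipschitz_on_def dist_norm)
      also have "\<dots> \<le> (LP + 1) * (Cstab * (A * E) powr (- \<beta>))"
        using G LP0 by (intro mult_mono) auto
      also have "\<dots> \<le> \<eta> / 2" using AE by (simp add: algebra_simps)
      finally show ?thesis .
    qed
    obtain \<Phi> where \<Phi>: "is_relu_net CARD('m) CARD('p) \<Phi>"
      "L2_norm_on \<nu> K (\<lambda>x. realize \<Phi> x - H x) \<le> ennreal \<eta>"
      "net_size \<Phi> \<le> M ^ CARD('m) * (6 * CARD('m) + 1 + CARD('p))" "net_depth \<Phi> = 2"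
      by (rule relu_net_approx_grid[OF \<nu> R(1) Rc M0 \<eta>(1) osc])
    \<comment> \<open>The 1 lost by rounding up is absorbed because
      \<open>exp (A * E) \<ge> 1\<close>.\<close>
    have "real M \<le> (B + 1) * exp (A * E)"
      using M(2) A E1 by (simp add: distrib_right) (smt (verit) mult_nonneg_nonneg one_le_exp_iff)
    then have "real M ^ CARD('m) \<le> ((B + 1) * exp (A * E)) ^ CARD('m)"
      by (intro power_mono) auto
    also have "\<dots> = (B + 1) ^ CARD('m) * exp (A * m * E)"
      by (simp add: power_mult_distrib m_def exp_of_nat_mult[symmetric] mult_ac)
    finally have Mm: "real M ^ CARD('m) \<le> (B + 1) ^ CARD('m) * exp (A * m * E)" .
    have "real (net_size \<Phi>) \<le> real (M ^ CARD('m) * (6 * CARD('m) + 1 + CARD('p)))"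
      using \<Phi>(3) by (simp only: of_nat_le_iff)
    also have "\<dots> = real M ^ CARD('m) * (6 * m + 1 + p)"
      by (simp add: m_def p_def algebra_simps)
    also have "\<dots> \<le> ((B + 1) ^ CARD('m) * exp (A * m * E)) * ((6 * m + 1) * (p + 1))"
      using Mm m p B by (intro mult_mono) (auto simp: algebra_simps)
    finally have "real (net_size \<Phi>) \<le> c0 * (p + 1) * exp (A * m * E)"
      by (simp add: c0_def mult_ac)
    \<comment> \<open>The depth is constantly 2, so any positive coefficient of \<open>m * E\<close>
      is admissible; 1 is taken.\<close>
    moreover have "real (net_depth \<Phi>) \<le> 2 + 1 * m * E"
      using \<Phi>(4) m E1 by simp
    ultimately show ?thesis using \<Phi>(1,2) unfolding E_def by blast
  qed
  have best: "best_error \<nu> K H N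
      \<le> ennreal ((1 / (A * m) * ln (real N / (c0 * (p + 1)))) powr (- \<beta>))"
    if N: "real N > c0 * (p + 1) * exp (A * m)" for N
  proof -
    \<comment> \<open>The value of \<open>\<eta>\<close> for which the size bound of the first part
      equals \<open>N\<close> exactly is \<open>Q powr (- \<beta>)\<close>. The assumed lower bound
      on \<open>N\<close> says \<open>Q > 1\<close>, that is, \<open>\<eta> < 1\<close>.\<close>
    define Q where "Q = 1 / (A * m) * ln (real N / (c0 * (p + 1)))"
    define \<eta> where "\<eta> = Q powr (- \<beta>)"
    have cp: "0 < c0 * (p + 1)" using c0 p by simp
    have Am: "0 < A * m" using A m by simp
    have N0: "0 < real N"
      using N cp by (smt (verit) exp_gt_zero mult_pos_pos)
    have "exp (A * m) < real N / (c0 * (p + 1))"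
      using N cp by (simp add: field_simps)
    then have "ln (exp (A * m)) < ln (real N / (c0 * (p + 1)))"
      using N0 cp by (subst ln_less_cancel_iff) auto
    then have Q: "1 < Q"
      using Am by (simp add: Q_def field_simps)
    have "Q powr (- \<beta>) < Q powr 0"
      using Q \<beta> by (intro powr_less_mono) auto
    then have \<eta>: "0 < \<eta>" "\<eta> < 1"
      using Q by (auto simp: \<eta>_def)
    have "\<eta> powr (- 1 / \<beta>) = Q"
      using Q \<beta> by (simp add: \<eta>_def powr_powr)
    then have "exp (A * m * \<eta> powr (- 1 / \<beta>)) = real N / (c0 * (p + 1))"
      using A m N0 cp by (simp add: Q_def)
    then have size: "c0 * (p + 1) * exp (A * m * \<eta> powr (- 1 / \<beta>)) = real N"
      using c0 p by simp
    obtain \<Phi> where \<Phi>: "is_relu_net CARD('m) CARD('p) \<Phi>" "net_size \<Phi> \<le> N"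
      "L2_norm_on \<nu> K (\<lambda>x. realize \<Phi> x - H x) \<le> ennreal \<eta>"
      using main[OF \<eta>] unfolding size by auto
    have "best_error \<nu> K H N \<le> L2_norm_on \<nu> K (\<lambda>x. realize \<Phi> x - H x)"
      unfolding best_error_def using \<Phi> by (intro INF_lower) simp
    also note \<Phi>(3)
    finally show ?thesis by (simp add: \<eta>_def Q_def)
  qed
  show ?thesis
    unfolding m_def[symmetric] p_def[symmetric]
    by (rule exI[of _ c0], rule exI[of _ A], rule exI[of _ 2], rule exI[of _ 1])
      (use c0 A main best in auto)
qed

end
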